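(* Let $n\in\mathbb{N}$. The simplices $\operatorname{conv}\{(\mathbf e_i,\mathbf e_{\overline j}):(i,\overline j)\in T\}$, for $T$ ranging over all cyclic $([n],[\overline n])$-trees, are exactly the maximal simplices of a triangulation of $\Delta_n\times\Delta_n=\operatorname{conv}\{(\mathbf e_i,\mathbf e_{\overline j}): i,j\in[n]\}\subset\mathbb{R}^{n+1}\times\mathbb{R}^{n+1}$, and this triangulation is flag and regular.
   Context: $[n]=\{0,\dots,n\}$, $[\overline n]=\{\overline 0,\dots,\overline n\}$. For $I\subseteq[n]$, $\overline J\subseteq[\overline n]$, arcs are pairs $(i,\overline j)\in I\times\overline J$. All differences below are taken modulo $n+1$ with representatives in $\{0,\dots,n\}$. Two arcs $(i,\overline j),(i',\overline{j'})$ cyclically cross if either ($j-i'<j-i$ and $j-i'<j'-i'$) or ($j'-i<j-i$ and $j'-i<j'-i'$). A cyclic $(I,\overline J)$-forest is a set of arcs no two of which cyclically cross; a cyclic $(I,\overline J)$-tree is a maximal cyclic $(I,\overline J)$-forest. *)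

theory Defs
  imports "HOL-Analysis.Analysis"
begin

section \<open>Cyclic forests and trees\<close>

text \<open>
  An arc $(i,\overline{j})$ is the pair \<open>(i, j) :: nat \<times> nat\<close>: the first component lives in $[n]$,
  the second one in the disjoint copy $[\overline{n}]$, so the bar is encoded by the position.
\<close>

definition cyc_diff :: "nat \<Rightarrow> nat \<Rightarrow> nat \<Rightarrow> nat" where
  "cyc_diff n b a = nat ((int b - int a) mod (int n + 1))"

definition cyclically_cross :: "nat \<Rightarrow> nat \<times> nat \<Rightarrow> nat \<times> nat \<Rightarrow> bool" where
  "cyclically_cross n = (\<lambda>(i, j) (i', j').
     (cyc_diff n j i' < cyc_diff n j i \<and> cyc_diff n j i' < cyc_diff n j' i') \<or>
     (cyc_diff n j' i < cyc_diff n j i \<and> cyc_diff n j' i < cyc_diff n j' i'))"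

definition cyclic_forest :: "nat \<Rightarrow> nat set \<Rightarrow> nat set \<Rightarrow> (nat \<times> nat) set \<Rightarrow> bool" where
  "cyclic_forest n I J T \<longleftrightarrow>
     T \<subseteq> I \<times> J \<and> pairwise (\<lambda>a b. \<not> cyclically_cross n a b) T"

definition cyclic_tree :: "nat \<Rightarrow> nat set \<Rightarrow> nat set \<Rightarrow> (nat \<times> nat) set \<Rightarrow> bool" where
  "cyclic_tree n I J T \<longleftrightarrow>
     cyclic_forest n I J T \<and> (\<forall>T'. cyclic_forest n I J T' \<and> T \<subseteq> T' \<longrightarrow> T' = T)"

section \<open>Triangulations of point configurations\<close>

text \<open>
  The library's \<^const>\<open>simplicial_complex\<close> is a finite set of geometric simplices closed under taking
  faces; the empty set counts as a face, so it belongs to every nonempty complex.  In particular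
  \<open>{v}\<close> is in the complex exactly if \<open>v\<close> is one of its vertices.
\<close>

definition triangulation_of ::
  "'a::euclidean_space set set \<Rightarrow> 'a set \<Rightarrow> bool" (infix \<open>triangulation'_of\<close> 50) where
  "\<C> triangulation_of V \<longleftrightarrow>
     simplicial_complex \<C> \<and> \<Union>\<C> = convex hull V \<and> {v. {v} \<in> \<C>} \<subseteq> V"

definition maximal_simplices :: "'a set set \<Rightarrow> 'a set set" where
  "maximal_simplices \<C> = {S \<in> \<C>. \<forall>S' \<in> \<C>. S \<subseteq> S' \<longrightarrow> S' = S}"

definition vertex_sets :: "'a::euclidean_space set set \<Rightarrow> 'a set set" where
  "vertex_sets \<C> = {C. \<not> affine_dependent C \<and> convex hull C \<in> \<C>}"

text \<open>
  A complex is flag if it is the clique complex of its graph.  The case \<open>x = y\<close> below says that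
  all elements of \<open>C\<close> are vertices of the complex.
\<close>

definition flag_complex :: "'a::euclidean_space set set \<Rightarrow> bool" where
  "flag_complex \<C> \<longleftrightarrow>
     (\<forall>C. (\<forall>x\<in>C. \<forall>y\<in>C. {x, y} \<in> vertex_sets \<C>) \<longrightarrow> C \<in> vertex_sets \<C>)"

text \<open>
  A lower face of a polytope in $E \times \mathbb{R}$ is a nonempty face cut out by a supporting
  hyperplane whose inner normal has positive last coordinate; this coordinate is scaled to 1.
\<close>

definition lower_face_of ::
  "('a::euclidean_space \<times> real) set \<Rightarrow> ('a \<times> real) set \<Rightarrow> bool" (infix \<open>lower'_face'_of\<close> 50) where
  "F lower_face_of P \<longleftrightarrow> F \<noteq> {} \<and>
     (\<exists>c b. P \<subseteq> {p. (c, 1) \<bullet> p \<ge> b} \<and> F = P \<inter> {p. (c, 1) \<bullet> p = b})"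

text \<open>
  A triangulation of the configuration \<open>V\<close> is regular if, for some choice of heights \<open>h\<close>, it
  consists of the projections of the lower faces of the lifted configuration.  Lower faces are
  nonempty, hence the removal of the empty simplex.
\<close>

definition regular_triangulation_of ::
  "'a::euclidean_space set set \<Rightarrow> 'a set \<Rightarrow> bool" (infix \<open>regular'_triangulation'_of\<close> 50) where
  "\<C> regular_triangulation_of V \<longleftrightarrow> \<C> triangulation_of V \<and>
     (\<exists>h :: 'a \<Rightarrow> real.
        \<C> - {{}} = {fst ` F | F. F lower_face_of (convex hull ((\<lambda>v. (v, h v)) ` V))})"

section \<open>Products of simplices\<close>

text \<open>
  $\mathbb{R}^{n+1}$ is rendered as \<open>real ^ 'n\<close>, its coordinates being labelled by $[n]$ via a
  bijection \<open>e\<close> from \<open>{0..n}\<close> onto the index type; thus \<open>axis (e i) 1\<close> is the basis vector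
  $\mathbf{e}_i$.
\<close>

definition arc_point :: "(nat \<Rightarrow> 'n::finite) \<Rightarrow> nat \<times> nat \<Rightarrow> (real ^ 'n) \<times> (real ^ 'n)" where
  "arc_point e = (\<lambda>(i, j). (axis (e i) 1, axis (e j) 1))"

definition arc_simplex ::
  "(nat \<Rightarrow> 'n::finite) \<Rightarrow> (nat \<times> nat) set \<Rightarrow> ((real ^ 'n) \<times> (real ^ 'n)) set" where
  "arc_simplex e T = convex hull (arc_point e ` T)"

definition simplex_product_points ::
  "nat \<Rightarrow> (nat \<Rightarrow> 'n::finite) \<Rightarrow> ((real ^ 'n) \<times> (real ^ 'n)) set" where
  "simplex_product_points n e = arc_point e ` ({0..n} \<times> {0..n})"

text \<open>The convex hull of this configuration is indeed $\Delta_n \times \Delta_n$.\<close>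

lemma convex_hull_simplex_product_points:
  fixes e :: "nat \<Rightarrow> 'n::finite"
  assumes "bij_betw e {0..n} UNIV"
  shows "convex hull (simplex_product_points n e) =
           (convex hull (range (\<lambda>k. axis k 1))) \<times> (convex hull (range (\<lambda>k. axis k 1)))"
proof -
  have e: "e ` {0..n} = UNIV"
    using assms by (simp add: bij_betw_def)
  have "arc_point e ` ({0..n} \<times> {0..n}) =
          (\<lambda>k. axis k 1) ` (e ` {0..n}) \<times> (\<lambda>k. axis k 1) ` (e ` {0..n})"
    unfolding arc_point_def by (force simp: image_iff)
  then show ?thesis
    by (simp add: simplex_product_points_def convex_hull_Times e)
qed

end

theory Submission
  imports Defs
begin

text \<open>
  Put \<open>d (i, j) = (j - i) mod (n + 1)\<close>.  Two arcs \<open>(i, j)\<close>, \<open>(i', j')\<close> cross iff the other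
  matching \<open>(i', j)\<close>, \<open>(i, j')\<close> of their end points has an arc with smaller \<open>d\<close> than both of them.
  Hence the heights \<open>- (1/2) ^ d\<close> make every crossing pair strictly higher than the exchanged pair,
  so that optimal transport plans between two given margins have noncrossing support.

  Conversely, a point has only one transport plan with noncrossing support: if \<open>z \<noteq> 0\<close> is the
  difference of two such plans and \<open>z (i, j) > 0\<close>, say, where \<open>d\<close> is minimal on the support
  of \<open>z\<close>, then row \<open>i\<close> and column \<open>j\<close> contain negative entries \<open>(i, j')\<close>, \<open>(i', j)\<close>, and
  these two arcs cross.  Thus noncrossing sets span simplices that meet in common faces, cover
  everything, and are the projected lower faces of the lifted configuration.
\<close>

section \<open>Triangulations from an exchange property\<close>

lemma convex_hull_image_finite:
  fixes p :: "'b \<Rightarrow> 'a::real_vector"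
  assumes fin: "finite V" and inj: "inj_on p V" and sub: "F \<subseteq> V"
  shows "convex hull (p ` F) =
    {y. \<exists>u. (\<forall>v\<in>V. 0 \<le> u v) \<and> sum u V = (1::real) \<and> (\<forall>v\<in>V-F. u v = 0)
          \<and> (\<Sum>v\<in>V. u v *\<^sub>R p v) = y}" (is "_ = ?R")
proof -
  have finF: "finite F" and injF: "inj_on p F"
    using assms by (auto intro: finite_subset inj_on_subset)
  have eq: "sum u V = sum u F" "(\<Sum>v\<in>V. u v *\<^sub>R p v) = (\<Sum>v\<in>F. u v *\<^sub>R p v)"
    if "\<forall>v\<in>V-F. u v = 0" for u :: "'b \<Rightarrow> real"
    using that by (auto intro!: sum.mono_neutral_right fin sub)
  show ?thesis
  proof (intro equalityI subsetI)
    fix y assume "y \<in> convex hull (p ` F)"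
    then obtain u where u: "\<forall>x\<in>p ` F. 0 \<le> u x" "sum u (p ` F) = 1"
        "(\<Sum>x\<in>p ` F. u x *\<^sub>R x) = y"
      using finF by (auto simp: convex_hull_finite)
    define w where "w = (\<lambda>v. if v \<in> F then u (p v) else 0)"
    have w0: "\<forall>v\<in>V-F. w v = 0" by (simp add: w_def)
    have "sum w V = 1" "(\<Sum>v\<in>V. w v *\<^sub>R p v) = y"
      unfolding eq[OF w0] using u by (simp_all add: w_def sum.reindex[OF injF] o_def)
    moreover have "\<forall>v\<in>V. 0 \<le> w v" using u(1) by (simp add: w_def)
    ultimately show "y \<in> ?R" using w0 by blast
  next
    fix y assume "y \<in> ?R"
    then obtain u where u: "\<forall>v\<in>V. 0 \<le> u v" "sum u V = 1" "\<forall>v\<in>V-F. u v = 0"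
        "(\<Sum>v\<in>V. u v *\<^sub>R p v) = y"
      by blast
    have "(\<Sum>v\<in>F. u v *\<^sub>R p v) \<in> convex hull (p ` F)"
      using u sub eq[OF u(3)] by (intro convex_sum[OF finF]) (auto intro: hull_inc)
    then show "y \<in> convex hull (p ` F)" using eq[OF u(3)] u(4) by simp
  qed
qed

text \<open>Abstracts what the construction needs of noncrossing arcs. \<open>conformal\<close>
  yields uniqueness of representations with pairwise \<open>ok\<close> support;
  \<open>exchange\<close> yields their existence, since a representation of least height can contain
  no bad pair, and is also the source of regularity.\<close>

locale exchange_configuration =
  fixes V :: "'a::euclidean_space set" and ok :: "'a \<Rightarrow> 'a \<Rightarrow> bool" and h :: "'a \<Rightarrow> real"
  assumes finite_V: "finite V"
    and conformal: "\<And>z. \<lbrakk>sum z V = 0; (\<Sum>v\<in>V. z v *\<^sub>R v) = 0;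
          pairwise ok {v\<in>V. z v > 0}; pairwise ok {v\<in>V. z v < 0}\<rbrakk> \<Longrightarrow> \<forall>v\<in>V. z v = (0::real)"
    and exchange: "\<And>a b. \<lbrakk>a \<in> V; b \<in> V; a \<noteq> b; \<not> ok a b\<rbrakk> \<Longrightarrow>
          \<exists>c\<in>V. \<exists>d\<in>V. a + b = c + d \<and> h c + h d < h a + h b"
begin

definition compatible :: "'a set \<Rightarrow> bool" where
  "compatible F \<longleftrightarrow> F \<subseteq> V \<and> pairwise ok F"

text \<open>For arcs, \<open>u\<close> is a transport plan of total mass 1 whose margins are the two
  components of \<open>x\<close>, and \<open>height u\<close> is its cost.\<close>

definition represents :: "('a \<Rightarrow> real) \<Rightarrow> 'a \<Rightarrow> bool" where
  "represents u x \<longleftrightarrow> (\<forall>v\<in>V. 0 \<le> u v) \<and> sum u V = 1 \<and> (\<Sum>v\<in>V. u v *\<^sub>R v) = x"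

definition height :: "('a \<Rightarrow> real) \<Rightarrow> real" where
  "height u = (\<Sum>v\<in>V. u v * h v)"

definition lift :: "'a \<Rightarrow> 'a \<times> real" where
  "lift v = (v, h v)"

definition complex :: "'a set set" where
  "complex = {convex hull F | F. compatible F}"

lemma compatible_subset: "compatible F \<Longrightarrow> G \<subseteq> F \<Longrightarrow> compatible G"
  by (auto simp: compatible_def intro: pairwise_subset)

lemma compatible_finite: "compatible F \<Longrightarrow> finite F"
  using finite_V finite_subset by (auto simp: compatible_def)

lemma compatible_sub: "compatible F \<Longrightarrow> F \<subseteq> V"
  by (simp add: compatible_def)

lemma mem_hull_iff:
  assumes "F \<subseteq> V"
  shows "x \<in> convex hull F \<longleftrightarrow> (\<exists>u. represents u x \<and> (\<forall>v\<in>V-F. u v = 0))"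
  using convex_hull_image_finite[OF finite_V _ assms, of "\<lambda>v. v"]
  by (auto simp: represents_def)

lemma mem_lift_hull_iff:
  assumes "F \<subseteq> V"
  shows "p \<in> convex hull (lift ` F) \<longleftrightarrow>
    (\<exists>u. represents u (fst p) \<and> height u = snd p \<and> (\<forall>v\<in>V-F. u v = 0))"
proof -
  have "inj_on lift V" by (auto simp: lift_def inj_on_def)
  moreover have "(\<Sum>v\<in>V. u v *\<^sub>R lift v) = ((\<Sum>v\<in>V. u v *\<^sub>R v), height u)" for u
    by (simp add: lift_def height_def prod_eq_iff fst_sum snd_sum)
  ultimately show ?thesis
    using convex_hull_image_finite[OF finite_V _ assms, of lift]
    by (cases p) (auto simp: represents_def)
qed

lemma fst_lift_hull:
  assumes "F \<subseteq> V"
  shows "fst ` (convex hull (lift ` F)) = convex hull F"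
proof (intro equalityI subsetI)
  fix x assume "x \<in> fst ` (convex hull (lift ` F))"
  then show "x \<in> convex hull F"
    using mem_hull_iff[OF assms] mem_lift_hull_iff[OF assms] by auto
next
  fix x assume "x \<in> convex hull F"
  then obtain u where "represents u x" "\<forall>v\<in>V-F. u v = 0" using mem_hull_iff[OF assms] by blast
  then have "(x, height u) \<in> convex hull (lift ` F)"
    using mem_lift_hull_iff[OF assms] by auto
  then show "x \<in> fst ` (convex hull (lift ` F))" by force
qed

section \<open>Uniqueness of compatible representations\<close>

text \<open>Weights are nonnegative, so \<open>u - w\<close> is positive only on the support of
  \<open>u\<close> and negative only on that of \<open>w\<close>; both sign classes are thus
  pairwise \<open>ok\<close>, and \<open>conformal\<close> applies.\<close>

lemma represents_unique:
  assumes "represents u x" "represents w x"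
    and "compatible {v\<in>V. u v \<noteq> 0}" "compatible {v\<in>V. w v \<noteq> 0}"
  shows "\<forall>v\<in>V. u v = w v"
proof -
  have "\<forall>v\<in>V. u v - w v = 0"
  proof (rule conformal)
    show "sum (\<lambda>v. u v - w v) V = 0" "(\<Sum>v\<in>V. (u v - w v) *\<^sub>R v) = 0"
      using assms by (auto simp: represents_def sum_subtractf scaleR_diff_left)
    have "{v\<in>V. u v - w v > 0} \<subseteq> {v\<in>V. u v \<noteq> 0}" "{v\<in>V. u v - w v < 0} \<subseteq> {v\<in>V. w v \<noteq> 0}"
      using assms by (force simp: represents_def)+
    then show "pairwise ok {v\<in>V. u v - w v > 0}" "pairwise ok {v\<in>V. u v - w v < 0}"
      using assms(3,4) by (auto simp: compatible_def intro: pairwise_subset)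
  qed
  then show ?thesis by simp
qed

text \<open>An affine dependence on \<open>F\<close>, extended by zero to \<open>V\<close>, has both
  sign classes inside \<open>F\<close>, so \<open>conformal\<close> kills it.\<close>

lemma compatible_independent:
  assumes "compatible F" shows "\<not> affine_dependent F"
proof
  assume "affine_dependent F"
  then obtain z where z: "sum z F = 0" "\<exists>v\<in>F. z v \<noteq> 0" "(\<Sum>v\<in>F. z v *\<^sub>R v) = 0"
    using affine_dependent_explicit_finite[OF compatible_finite[OF assms]] by auto
  define w where "w = (\<lambda>v. if v \<in> F then z v else 0)"
  have FV: "F \<subseteq> V" using assms by (simp add: compatible_def)
  have "sum w V = sum z F" "(\<Sum>v\<in>V. w v *\<^sub>R v) = (\<Sum>v\<in>F. z v *\<^sub>R v)"
    using FV by (auto simp: w_def intro!: sum.mono_neutral_cong_right finite_V)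
  moreover have "pairwise ok {v\<in>V. w v > 0}" "pairwise ok {v\<in>V. w v < 0}"
    using assms by (auto simp: w_def compatible_def intro: pairwise_subset split: if_splits)
  ultimately have "\<forall>v\<in>V. w v = 0" using z by (intro conformal) auto
  then have "\<forall>v\<in>F. z v = 0" using FV unfolding w_def by (metis subsetD)
  then show False using z(2) by blast
qed

section \<open>Compatible representations as height minimisers\<close>

text \<open>Shifting mass from a bad pair \<open>a\<close>, \<open>b\<close> to its exchange pair
  \<open>c\<close>, \<open>d\<close> preserves the represented point and lowers the height.\<close>

lemma minimal_representation_compatible:
  assumes u: "represents u x" and min: "\<And>w. represents w x \<Longrightarrow> height u \<le> height w"
  shows "compatible {v\<in>V. u v \<noteq> 0}"
proof -
  have "ok a b" if ab: "a \<in> V" "b \<in> V" "u a \<noteq> 0" "u b \<noteq> 0" "a \<noteq> b" for a b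
  proof (rule ccontr)
    assume "\<not> ok a b"
    then obtain c d where cd: "c \<in> V" "d \<in> V" "a + b = c + d" "h c + h d < h a + h b"
      using exchange ab by blast
    \<comment> \<open>The largest mass that can be taken from both \<open>a\<close> and
      \<open>b\<close>; as \<open>a \<noteq> b\<close>, no point loses it twice.\<close>
    define eps where "eps = min (u a) (u b)"
    have eps: "eps > 0" "eps \<le> u a" "eps \<le> u b"
      using u ab by (auto simp: eps_def represents_def less_le)
    \<comment> \<open>Adding and subtracting point masses keeps the sums correct even when some of
      the four points coincide, for instance \<open>c = d\<close>.\<close>
    define ind :: "'a \<Rightarrow> 'a \<Rightarrow> real" where "ind = (\<lambda>s v. if v = s then eps else 0)"
    have ind: "sum (ind s) V = eps" "(\<Sum>v\<in>V. ind s v *\<^sub>R v) = eps *\<^sub>R s"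
        "(\<Sum>v\<in>V. ind s v * h v) = eps * h s" if "s \<in> V" for s
      using that finite_V by (simp_all add: ind_def if_distrib[of "\<lambda>t. t *\<^sub>R _"]
          if_distrib[of "\<lambda>t. t * _"] cong: if_cong)
    define w where "w = (\<lambda>v. u v + ind c v + ind d v - ind a v - ind b v)"
    have "sum w V = 1" using u ab cd
      by (simp add: w_def sum.distrib sum_subtractf ind represents_def)
    moreover have "(\<Sum>v\<in>V. w v *\<^sub>R v) = x"
    proof -
      have "(\<Sum>v\<in>V. w v *\<^sub>R v) = x + (eps *\<^sub>R (c + d) - eps *\<^sub>R (a + b))"
        using u ab cd(1,2)
        by (simp add: w_def sum.distrib sum_subtractf ind represents_def scaleR_left_distrib
            scaleR_left_diff_distrib scaleR_right_distrib)
      then show ?thesis using cd(3) by simp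
    qed
    moreover have "\<forall>v\<in>V. 0 \<le> w v"
      using u eps ab by (auto simp: w_def ind_def represents_def)
    ultimately have "represents w x" by (simp add: represents_def)
    moreover have "height w = height u + eps * ((h c + h d) - (h a + h b))"
      using ab cd(1,2)
      by (simp add: height_def w_def sum.distrib sum_subtractf ind distrib_right left_diff_distrib)
         (simp add: algebra_simps)
    then have "height w < height u"
      using eps cd(4) by (simp add: mult_pos_neg)
    ultimately show False using min by force
  qed
  then show ?thesis by (auto simp: compatible_def pairwise_def)
qed

text \<open>The fibre of the lifted polytope over \<open>x\<close> is compact and nonempty, so its
  last coordinate attains a minimum.\<close>

lemma minimal_representation_exists:
  assumes "x \<in> convex hull V"
  obtains u where "represents u x" "\<And>w. represents w x \<Longrightarrow> height u \<le> height w"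
proof -
  let ?P = "convex hull (lift ` V) \<inter> {p. fst p = x}"
  have "compact (convex hull (lift ` V))"
    using finite_V by (simp add: finite_imp_compact_convex_hull)
  moreover have "closed {p :: 'a \<times> real. fst p = x}"
    by (intro closed_Collect_eq continuous_intros)
  ultimately have "compact ?P" by blast
  moreover have "?P \<noteq> {}" using assms fst_lift_hull[of V] by force
  moreover have "continuous_on ?P snd" by (intro continuous_intros)
  ultimately obtain p where p: "p \<in> ?P" "\<forall>q\<in>?P. snd p \<le> snd q"
    using continuous_attains_inf by metis
  then obtain u where u: "represents u x" "height u = snd p"
    using mem_lift_hull_iff[of V p] by auto
  have "height u \<le> height w" if "represents w x" for w
    using p(2)[rule_format, of "(x, height w)"] that u(2) mem_lift_hull_iff[of V "(x, height w)"]
    by auto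
  with u(1) show ?thesis using that by blast
qed

text \<open>A minimiser \<open>m\<close> is compatible, hence agrees with \<open>u\<close> by
  uniqueness, so \<open>u\<close> is minimal. Then \<open>w\<close>, being no higher, is minimal and
  compatible too, and uniqueness applies once more.\<close>

lemma compatible_optimal:
  assumes u: "represents u x" "compatible {v\<in>V. u v \<noteq> 0}"
    and w: "represents w x" "height w \<le> height u"
  shows "\<forall>v\<in>V. w v = u v"
proof -
  have "x \<in> convex hull V" using u(1) mem_hull_iff[of V] by auto
  then obtain m where m: "represents m x" "\<And>w. represents w x \<Longrightarrow> height m \<le> height w"
    using minimal_representation_exists by metis
  have "compatible {v\<in>V. m v \<noteq> 0}" by (rule minimal_representation_compatible[OF m])
  then have "\<forall>v\<in>V. m v = u v" by (rule represents_unique[OF m(1) u(1) _ u(2)])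
  then have "height m = height u" by (simp add: height_def)
  then have "height w \<le> height w'" if "represents w' x" for w' using m(2)[OF that] w(2) by linarith
  then have "compatible {v\<in>V. w v \<noteq> 0}" by (rule minimal_representation_compatible[OF w(1)])
  then show ?thesis by (rule represents_unique[OF w(1) u(1) _ u(2)])
qed

section \<open>The simplicial complex of compatible sets\<close>

lemma covering:
  assumes "x \<in> convex hull V" obtains F where "compatible F" "x \<in> convex hull F"
proof -
  obtain u where u: "represents u x" "\<And>w. represents w x \<Longrightarrow> height u \<le> height w"
    using minimal_representation_exists[OF assms] by metis
  have "x \<in> convex hull {v\<in>V. u v \<noteq> 0}" using u(1) by (subst mem_hull_iff) auto
  then show ?thesis using that minimal_representation_compatible[OF u] by blast
qed

lemma compatible_support:
  "compatible F \<Longrightarrow> \<forall>v\<in>V-F. u v = 0 \<Longrightarrow> compatible {v\<in>V. u v \<noteq> 0}"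
  by (erule compatible_subset) auto

text \<open>A common point has one compatible representation only, so its weights vanish both off
  \<open>F\<close> and off \<open>G\<close>.\<close>

lemma hull_Int:
  assumes "compatible F" "compatible G"
  shows "convex hull F \<inter> convex hull G = convex hull (F \<inter> G)"
proof (intro equalityI subsetI)
  fix x assume "x \<in> convex hull F \<inter> convex hull G"
  then obtain u w where u: "represents u x" "\<forall>v\<in>V-F. u v = 0"
    and w: "represents w x" "\<forall>v\<in>V-G. w v = 0"
    using mem_hull_iff compatible_sub assms by (metis IntE)
  have "\<forall>v\<in>V. u v = w v"
    using represents_unique[OF u(1) w(1)] compatible_support assms u(2) w(2) by blast
  then have "\<forall>v\<in>V-(F \<inter> G). u v = 0" using u(2) w(2) by auto
  then show "x \<in> convex hull (F \<inter> G)"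
    using u(1) mem_hull_iff[of "F \<inter> G"] compatible_sub[OF assms(1)] by blast
next
  fix x assume "x \<in> convex hull (F \<inter> G)"
  then show "x \<in> convex hull F \<inter> convex hull G"
    using hull_mono[of "F \<inter> G"] by blast
qed

text \<open>By affine independence the generators are exactly the extreme points of the hull, so
  they can be recovered from it.\<close>

lemma hull_subset_iff:
  assumes "compatible F" "compatible G"
  shows "convex hull F \<subseteq> convex hull G \<longleftrightarrow> F \<subseteq> G"
proof
  assume "convex hull F \<subseteq> convex hull G"
  then have "convex hull (F \<inter> G) = convex hull F" using hull_Int[OF assms] by auto
  then have "\<And>v. v extreme_point_of (convex hull (F \<inter> G)) \<longleftrightarrow> v extreme_point_of (convex hull F)"
    by simp
  then show "F \<subseteq> G"
    using compatible_independent assms(1) compatible_subset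
    by (metis extreme_point_of_convex_hull_affine_independent inf_le1 inf_le2 subset_iff)
qed (rule hull_mono)

lemma hull_eq_iff:
  "compatible F \<Longrightarrow> compatible G \<Longrightarrow> convex hull F = convex hull G \<longleftrightarrow> F = G"
  using hull_subset_iff by (metis subset_antisym subset_refl)

lemma face_of_hull_iff:
  "compatible F \<Longrightarrow> S face_of (convex hull F) \<longleftrightarrow> (\<exists>G\<subseteq>F. S = convex hull G)"
  using face_of_convex_hull_affine_independent[OF compatible_independent] by metis

lemma vertex_sets_complex: "vertex_sets complex = {F. compatible F}"
proof -
  have "C = F" if "\<not> affine_dependent C" "convex hull C = convex hull F" "compatible F" for C F
    using extreme_point_of_convex_hull_affine_independent[OF that(1)]
      extreme_point_of_convex_hull_affine_independent[OF compatible_independent[OF that(3)]] that(2)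
    by auto
  then show ?thesis
    unfolding vertex_sets_def complex_def by (auto simp: compatible_independent)
qed

lemma simplicial_complex_complex: "simplicial_complex complex"
  unfolding simplicial_complex_def
proof (intro conjI ballI allI impI)
  have "complex \<subseteq> (\<lambda>F. convex hull F) ` Pow V" by (auto simp: complex_def compatible_def)
  then show "finite complex" using finite_V finite_subset by blast
next
  fix S assume "S \<in> complex"
  then obtain F where F: "compatible F" "S = convex hull F" by (auto simp: complex_def)
  \<comment> \<open>For \<open>F = {}\<close> this is the empty simplex, of dimension -1.\<close>
  then have "(int (card F) - 1) simplex S" unfolding F(2)
    by (intro simplex_convex_hull) (simp_all add: compatible_independent)
  then show "\<exists>k. k simplex S" ..
next
  fix S T assume "T \<in> complex \<and> S face_of T"
  then show "S \<in> complex"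
    unfolding complex_def using face_of_hull_iff compatible_subset by blast
next
  fix S T assume "S \<in> complex \<and> T \<in> complex"
  then obtain F G where F: "compatible F" "S = convex hull F" and G: "compatible G" "T = convex hull G"
    by (auto simp: complex_def)
  then show "(S \<inter> T) face_of S"
    unfolding F(2) G(2) face_of_hull_iff[OF F(1)] hull_Int[OF F(1) G(1)] by blast
qed

lemma triangulation_complex: "complex triangulation_of V"
  unfolding triangulation_of_def
proof (intro conjI simplicial_complex_complex)
  show "\<Union>complex = convex hull V"
  proof (intro equalityI subsetI)
    fix x assume "x \<in> \<Union>complex"
    then obtain F where "compatible F" "x \<in> convex hull F" by (auto simp: complex_def)
    then show "x \<in> convex hull V" using hull_mono[OF compatible_sub, of F convex] by auto
  next
    fix x assume "x \<in> convex hull V"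
    then obtain F where "compatible F" "x \<in> convex hull F" by (rule covering)
    then show "x \<in> \<Union>complex" by (auto simp: complex_def)
  qed
  have "{v} \<in> vertex_sets complex" if "{v} \<in> complex" for v
    using that by (simp add: vertex_sets_def)
  then show "{v. {v} \<in> complex} \<subseteq> V"
    unfolding vertex_sets_complex by (auto simp: compatible_def)
qed

text \<open>Compatibility is tested on pairs, and the case \<open>x = y\<close> supplies membership
  in \<open>V\<close>.\<close>

lemma flag_complex_complex: "flag_complex complex"
  unfolding flag_complex_def vertex_sets_complex mem_Collect_eq
proof (intro allI impI)
  fix C assume C: "\<forall>x\<in>C. \<forall>y\<in>C. compatible {x, y}"
  then have "x \<in> V" if "x \<in> C" for x using that by (auto simp: compatible_def)
  moreover have "ok x y" if "x \<in> C" "y \<in> C" "x \<noteq> y" for x y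
    using C that by (auto simp: compatible_def pairwise_insert)
  ultimately show "compatible C" unfolding compatible_def pairwise_def by blast
qed

lemma maximal_simplices_complex:
  "maximal_simplices complex =
     {convex hull F | F. compatible F \<and> (\<forall>G. compatible G \<and> F \<subseteq> G \<longrightarrow> G = F)}"
proof (intro equalityI subsetI)
  fix S assume S: "S \<in> maximal_simplices complex"
  then obtain F where F: "compatible F" "S = convex hull F"
    by (auto simp: maximal_simplices_def complex_def)
  have "G = F" if "compatible G" "F \<subseteq> G" for G
  proof -
    have "convex hull G \<in> complex" using that by (auto simp: complex_def)
    then have "convex hull G = convex hull F"
      using S F(2) hull_mono[OF that(2), of convex] unfolding maximal_simplices_def by blast
    then show ?thesis using hull_eq_iff[OF that(1) F(1)] by blast
  qed
  then show "S \<in> {convex hull F | F. compatible F \<and> (\<forall>G. compatible G \<and> F \<subseteq> G \<longrightarrow> G = F)}"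
    using F by blast
next
  fix S assume "S \<in> {convex hull F | F. compatible F \<and> (\<forall>G. compatible G \<and> F \<subseteq> G \<longrightarrow> G = F)}"
  then obtain F where F: "compatible F" "S = convex hull F"
      and max: "\<And>G. compatible G \<Longrightarrow> F \<subseteq> G \<Longrightarrow> G = F"
    by blast
  have "S' = S" if S': "S' \<in> complex" "S \<subseteq> S'" for S'
  proof -
    obtain G where G: "compatible G" "S' = convex hull G" using S'(1) by (auto simp: complex_def)
    then have "F \<subseteq> G" using hull_subset_iff[OF F(1) G(1)] F(2) S'(2) by blast
    then show ?thesis using max[OF G(1)] F(2) G(2) by blast
  qed
  then show "S \<in> maximal_simplices complex"
    using F by (auto simp: maximal_simplices_def complex_def)
qed

section \<open>Regularity through lower faces\<close>

lemma represents_convex_combination: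
  assumes "represents u x" "represents w y" "0 \<le> t" "t \<le> 1"
  shows "represents (\<lambda>v. (1 - t) * u v + t * w v) ((1 - t) *\<^sub>R x + t *\<^sub>R y)"
  using assms
  by (auto simp: represents_def sum.distrib scaleR_add_left scaleR_right.sum
      simp flip: sum_distrib_left)

lemma height_convex_combination:
  "height (\<lambda>v. (1 - t) * u v + t * w v) = (1 - t) * height u + t * height w"
  by (simp add: height_def sum.distrib distrib_right sum_distrib_left mult.assoc)

text \<open>The region on and above the graph of the minimal height function on
  \<open>convex hull V\<close>. Being unbounded upwards, it keeps only the lower side of the lifted
  polytope.\<close>

definition epigraph :: "('a \<times> real) set" where
  "epigraph = {p. \<exists>u. represents u (fst p) \<and> height u \<le> snd p}"

lemma convex_epigraph: "convex epigraph"
  unfolding convex_alt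
proof (intro ballI allI impI)
  fix p q :: "'a \<times> real" and t :: real
  assume pq: "p \<in> epigraph" "q \<in> epigraph" and t: "0 \<le> t \<and> t \<le> 1"
  then obtain u w where "represents u (fst p)" "height u \<le> snd p"
      "represents w (fst q)" "height w \<le> snd q"
    by (auto simp: epigraph_def)
  then show "(1 - t) *\<^sub>R p + t *\<^sub>R q \<in> epigraph"
    unfolding epigraph_def using t represents_convex_combination[of u "fst p" w "fst q" t]
    by (auto intro!: exI[of _ "\<lambda>v. (1 - t) * u v + t * w v"] add_mono mult_left_mono
        simp: height_convex_combination)
qed

lemma represents_vertex:
  assumes "a \<in> V"
  obtains u where "represents u a" "height u = h a"
proof
  let ?u = "\<lambda>v. if v = a then 1 else (0::real)"
  show "represents ?u a" "height ?u = h a"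
    using assms finite_V by (simp_all add: represents_def height_def if_distrib[of "\<lambda>t. t *\<^sub>R _"]
        if_distrib[of "\<lambda>t. t * _"] cong: if_cong)
qed

text \<open>If \<open>r\<close> lies strictly between \<open>p\<close> and \<open>q\<close>, mixing
  their witnesses represents \<open>fst r\<close> at height at most \<open>snd r\<close>. By
  optimality the mixture is the compatible representation of \<open>r\<close>, which leaves no slack
  in height and no mass off \<open>F\<close>.\<close>

lemma lift_hull_face_of_epigraph:
  assumes F: "compatible F"
  shows "(convex hull (lift ` F)) face_of epigraph"
  unfolding face_of_def
proof (intro conjI ballI impI convex_convex_hull)
  note FV = compatible_sub[OF F]
  show "convex hull (lift ` F) \<subseteq> epigraph"
    using mem_lift_hull_iff[OF FV] by (auto simp: epigraph_def)
  fix p q r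
  assume "p \<in> epigraph" "q \<in> epigraph" and r: "r \<in> convex hull (lift ` F)"
    and "r \<in> open_segment p q"
  then obtain t where t: "0 < t" "t < 1" "r = (1 - t) *\<^sub>R p + t *\<^sub>R q"
    by (auto simp: in_segment)
  obtain u w where u: "represents u (fst p)" "height u \<le> snd p"
    and w: "represents w (fst q)" "height w \<le> snd q"
    using \<open>p \<in> epigraph\<close> \<open>q \<in> epigraph\<close> by (auto simp: epigraph_def)
  obtain m where m: "represents m (fst r)" "height m = snd r" "\<forall>v\<in>V-F. m v = 0"
    using r mem_lift_hull_iff[OF FV] by blast
  let ?c = "\<lambda>v. (1 - t) * u v + t * w v"
  have hp: "(1 - t) * height u \<le> (1 - t) * snd p" and hq: "t * height w \<le> t * snd q"
    using t u w by (auto intro: mult_left_mono)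
  have "\<forall>v\<in>V. ?c v = m v"
  proof (rule compatible_optimal[OF m(1)])
    show "compatible {v \<in> V. m v \<noteq> 0}" using F m(3) by (rule compatible_support)
    show "represents ?c (fst r)"
      using represents_convex_combination[OF u(1) w(1), of t] t by simp
    show "height ?c \<le> height m"
      unfolding height_convex_combination m(2) using hp hq t(3) by simp
  qed
  then have "height ?c = height m" by (simp add: height_def)
  then have "(1 - t) * height u + t * height w = (1 - t) * snd p + t * snd q"
    using t(3) by (simp add: height_convex_combination m(2))
  \<comment> \<open>Two inequalities whose sum is an equality are both equalities.\<close>
  then have "(1 - t) * height u = (1 - t) * snd p" "t * height w = t * snd q"
    using hp hq by linarith+
  then have heq: "height u = snd p" "height w = snd q" using t by auto
  have "u v = 0 \<and> w v = 0" if "v \<in> V - F" for v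
  proof -
    have "(1 - t) * u v + t * w v = 0" "0 \<le> u v" "0 \<le> w v"
      using \<open>\<forall>v\<in>V. ?c v = m v\<close> m(3) that u(1) w(1) by (auto simp: represents_def)
    then show ?thesis using t by (simp add: add_nonneg_eq_0_iff)
  qed
  then show "p \<in> convex hull (lift ` F)" "q \<in> convex hull (lift ` F)"
    using u(1) w(1) heq mem_lift_hull_iff[OF FV] by blast+
qed

text \<open>The face of the epigraph is also a face of any set between it and the epigraph. For a
  polytope \<open>Q\<close> in between, faces are exposed, which provides the required
  hyperplane.\<close>

lemma lift_hull_lower_face:
  assumes F: "compatible F" and ne: "F \<noteq> {}"
  shows "(convex hull (lift ` F)) lower_face_of (convex hull (lift ` V))"
proof -
  note FV = compatible_sub[OF F]
  let ?S = "convex hull (lift ` F)"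
  obtain B where B: "\<forall>v\<in>V. h v < B"
    using finite_V by (metis bdd_above_finite bdd_above.E finite_imageI gt_ex imageI le_less_trans)
  \<comment> \<open>The upper copy of \<open>V\<close> at height \<open>B\<close> excludes supporting hyperplanes whose normal is vertical or points down.\<close>
  define Q where "Q = convex hull (lift ` V \<union> (\<lambda>v. (v, B)) ` V)"
  have PQ: "convex hull (lift ` V) \<subseteq> Q" unfolding Q_def by (intro hull_mono) auto
  have "Q \<subseteq> epigraph" unfolding Q_def
  proof (rule hull_minimal[of _ _ convex, OF _ convex_epigraph])
    have "(v, h v) \<in> epigraph \<and> (v, B) \<in> epigraph" if v: "v \<in> V" for v
    proof -
      obtain u where u: "represents u v" "height u = h v" using v by (rule represents_vertex)
      then show ?thesis using B v unfolding epigraph_def by (force intro: less_imp_le)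
    qed
    then show "lift ` V \<union> (\<lambda>v. (v, B)) ` V \<subseteq> epigraph" by (auto simp: lift_def)
  qed
  moreover have SP: "?S \<subseteq> convex hull (lift ` V)" using FV by (intro hull_mono) auto
  ultimately have "?S face_of Q"
    using lift_hull_face_of_epigraph[OF F] PQ by (meson face_of_subset order_trans)
  moreover have "polyhedron Q" unfolding Q_def using finite_V by (simp add: polyhedron_convex_hull)
  ultimately have "?S exposed_face_of Q" by (simp add: exposed_face_of_polyhedron)
  then obtain a b where ab: "Q \<subseteq> {p. a \<bullet> p \<le> b}" "?S = Q \<inter> {p. a \<bullet> p = b}"
    by (auto simp: exposed_face_of_def)
  obtain v where v: "v \<in> F" using ne by blast
  then have vV: "v \<in> V" using FV by blast
  have "(v, B) \<notin> ?S"
  proof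
    assume "(v, B) \<in> ?S"
    then obtain u where u: "represents u v" "height u = B" "\<forall>v\<in>V-F. u v = 0"
      using mem_lift_hull_iff[OF FV] by auto
    have "\<exists>v\<in>V. u v \<noteq> 0" using u(1) by (metis represents_def sum.neutral zero_neq_one)
    then obtain k where k: "k \<in> V" "u k > 0" using u(1) by (auto simp: represents_def less_le)
    \<comment> \<open>A weighted average of heights that all lie strictly below \<open>B\<close>
      cannot reach \<open>B\<close>.\<close>
    have "height u < (\<Sum>v\<in>V. u v * B)" unfolding height_def
    proof (rule sum_strict_mono_ex1[OF finite_V])
      show "\<forall>x\<in>V. u x * h x \<le> u x * B"
        using u(1) B by (simp add: represents_def less_imp_le mult_left_mono)
      show "\<exists>x\<in>V. u x * h x < u x * B" using k B by (intro bexI[of _ k]) auto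
    qed
    also have "\<dots> = B" using u(1) by (simp add: represents_def flip: sum_distrib_right)
    finally show False using u(2) by simp
  qed
  moreover have "(v, B) \<in> Q" unfolding Q_def using vV by (intro hull_inc) auto
  ultimately have vB: "a \<bullet> (v, B) < b" using ab by fastforce
  have "(v, h v) \<in> ?S" using v by (intro hull_inc) (auto simp: lift_def)
  then have vh: "a \<bullet> (v, h v) = b" using ab by blast
  obtain a1 a2 where a: "a = (a1, a2)" by (cases a)
  \<comment> \<open>The points \<open>(v, h v)\<close> on the hyperplane and \<open>(v, B)\<close>
    strictly on its inner side differ only in the last coordinate, which fixes the sign of
    \<open>a2\<close>. Dividing by \<open>a2\<close> then turns the outer normal into an inner one
    with last coordinate 1.\<close>
  have "a2 * B < a2 * h v" using vB vh by (simp add: a)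
  then have neg: "a2 < 0" using B vV by (smt (verit) mult_left_mono)
  have scaled: "(a1 /\<^sub>R a2, 1) \<bullet> p = (a \<bullet> p) / a2" for p
    using neg by (cases p) (simp add: a field_simps)
  show ?thesis unfolding lower_face_of_def
  proof (intro conjI exI)
    show "?S \<noteq> {}" using ne by simp
    show "convex hull (lift ` V) \<subseteq> {p. b / a2 \<le> (a1 /\<^sub>R a2, 1) \<bullet> p}"
      using ab(1) PQ neg unfolding scaled by (auto simp: divide_right_mono_neg)
    show "?S = convex hull (lift ` V) \<inter> {p. (a1 /\<^sub>R a2, 1) \<bullet> p = b / a2}"
      unfolding scaled using neg SP PQ ab(2) by auto
  qed
qed

text \<open>The functional \<open>(c, 1)\<close> takes its minimum \<open>b\<close> at both members
  of a pair in the face. Exchanging a bad pair would produce two lifted points with values summing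
  to less than \<open>2 * b\<close>.\<close>

lemma lower_face_compatible:
  assumes "S lower_face_of (convex hull (lift ` V))"
  obtains F where "compatible F" "F \<noteq> {}" "fst ` S = convex hull F"
proof -
  let ?P = "convex hull (lift ` V)"
  obtain c b where S: "S \<noteq> {}" "?P \<subseteq> {p. (c, 1) \<bullet> p \<ge> b}" "S = ?P \<inter> {p. (c, 1) \<bullet> p = b}"
    using assms by (auto simp: lower_face_of_def)
  have "S face_of ?P"
    unfolding S(3) using S(2) by (intro face_of_Int_supporting_hyperplane_ge) auto
  moreover have "compact (lift ` V)" using finite_V by (simp add: finite_imp_compact)
  ultimately obtain S' where "S' \<subseteq> lift ` V" "S = convex hull S'"
    using face_of_convex_hull_subset by metis
  then obtain F where F: "F \<subseteq> V" "S = convex hull (lift ` F)" by (metis subset_image_iff)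
  have ge: "c \<bullet> v + h v \<ge> b" if "v \<in> V" for v
  proof -
    have "lift v \<in> ?P" using that by (intro hull_inc) auto
    then show ?thesis using S(2) by (auto simp: lift_def)
  qed
  have eq: "c \<bullet> v + h v = b" if "v \<in> F" for v
  proof -
    have "lift v \<in> S" unfolding F using that by (intro hull_inc) auto
    then show ?thesis using S(3) by (simp add: lift_def)
  qed
  have "ok x y" if xy: "x \<in> F" "y \<in> F" "x \<noteq> y" for x y
  proof (rule ccontr)
    assume "\<not> ok x y"
    then obtain r s where rs: "r \<in> V" "s \<in> V" "x + y = r + s" "h r + h s < h x + h y"
      using exchange xy F(1) by blast
    have "c \<bullet> x + c \<bullet> y = c \<bullet> r + c \<bullet> s" using rs(3) by (simp flip: inner_add_right)
    then show False using eq[OF xy(1)] eq[OF xy(2)] ge[OF rs(1)] ge[OF rs(2)] rs(4) by linarith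
  qed
  then have "compatible F" using F(1) by (auto simp: compatible_def pairwise_def)
  moreover have "F \<noteq> {}" using S(1) F(2) by auto
  ultimately show ?thesis using that fst_lift_hull[OF F(1)] F(2) by blast
qed

lemma regular_triangulation_complex: "complex regular_triangulation_of V"
  unfolding regular_triangulation_of_def
proof (intro conjI triangulation_complex exI[of _ h])
  have "S \<in> complex - {{}} \<longleftrightarrow>
      (\<exists>F. S = fst ` F \<and> F lower_face_of (convex hull (lift ` V)))" for S
  proof
    assume S: "S \<in> complex - {{}}"
    then obtain F where F: "compatible F" "S = convex hull F" by (auto simp: complex_def)
    with S have "F \<noteq> {}" by auto
    with F show "\<exists>F. S = fst ` F \<and> F lower_face_of (convex hull (lift ` V))"
      using lift_hull_lower_face[of F] fst_lift_hull[OF compatible_sub, of F] by blast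
  next
    assume "\<exists>F. S = fst ` F \<and> F lower_face_of (convex hull (lift ` V))"
    then obtain F where "compatible F" "F \<noteq> {}" "S = convex hull F"
      using lower_face_compatible by blast
    then show "S \<in> complex - {{}}" by (auto simp: complex_def)
  qed
  then show "complex - {{}} =
      {fst ` F | F. F lower_face_of (convex hull ((\<lambda>v. (v, h v)) ` V))}"
    by (auto simp: lift_def[abs_def])
qed

end

section \<open>Noncrossing arcs\<close>

text \<open>Modulo \<open>n + 1\<close> the difference and one end determine the other end, and
  labels in \<open>{0..n}\<close> that are congruent are equal. This makes comparisons strict
  between arcs sharing exactly one end.\<close>

lemma cyc_diff_cong:
  assumes "a \<le> n" "b \<le> n" "a' \<le> n" "b' \<le> n" "cyc_diff n b a = cyc_diff n b' a'"
  shows "a = a' \<longleftrightarrow> b = b'"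
proof -
  have "(int b - int a) mod (int n + 1) = (int b' - int a') mod (int n + 1)"
    using assms(5) by (simp add: cyc_diff_def eq_nat_nat_iff)
  then have dv: "int n + 1 dvd (int b - int a) - (int b' - int a')"
    by (simp add: mod_eq_dvd_iff)
  have eqI: "x = y" if "int n + 1 dvd int x - int y" "x \<le> n" "y \<le> n" for x y
    using dvd_imp_le_int[OF _ that(1)] that(2,3) by fastforce
  show ?thesis
  proof
    assume "a = a'"
    then show "b = b'" using dv assms by (intro eqI) auto
  next
    assume "b = b'"
    then have "int n + 1 dvd int a' - int a" using dv by simp
    then show "a = a'" using eqI assms by metis
  qed
qed

lemma ex_neg_if_sum_zero:
  fixes f :: "'a \<Rightarrow> real"
  assumes "finite A" "sum f A = 0" "a \<in> A" "f a > 0"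
  obtains b where "b \<in> A" "f b < 0"
  using assms by (metis not_less sum_pos2 less_irrefl)

text \<open>The case where the least arc of the support is positive; the other case follows by
  passing to \<open>- z\<close>. The contradiction comes from two arcs of the opposite sign.\<close>

lemma least_positive_arc_absurd:
  fixes z :: "nat \<times> nat \<Rightarrow> real"
  assumes rows: "\<And>i. i \<le> n \<Longrightarrow> (\<Sum>j=0..n. z (i, j)) = 0"
    and cols: "\<And>j. j \<le> n \<Longrightarrow> (\<Sum>i=0..n. z (i, j)) = 0"
    and neg: "pairwise (\<lambda>a b. \<not> cyclically_cross n a b) {a \<in> {0..n} \<times> {0..n}. z a < 0}"
    and ij: "i \<le> n" "j \<le> n" "z (i, j) > 0"
    and least: "\<And>i' j'. i' \<le> n \<Longrightarrow> j' \<le> n \<Longrightarrow> z (i', j') \<noteq> 0 \<Longrightarrow> cyc_diff n j i \<le> cyc_diff n j' i'"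
  shows False
proof -
  obtain j' where j': "j' \<le> n" "z (i, j') < 0"
    using ex_neg_if_sum_zero[of "{0..n}" "\<lambda>j. z (i, j)" j] rows ij by auto
  obtain i' where i': "i' \<le> n" "z (i', j) < 0"
    using ex_neg_if_sum_zero[of "{0..n}" "\<lambda>i. z (i, j)" i] cols ij by auto
  have ne: "i' \<noteq> i" "j' \<noteq> j" using ij i' j' by auto
  \<comment> \<open>Minimality gives only weak inequalities; each of these arcs shares exactly one
    end with \<open>(i, j)\<close>, which excludes equality.\<close>
  have "cyc_diff n j i < cyc_diff n j' i" "cyc_diff n j i < cyc_diff n j i'"
    using least[of i j'] least[of i' j] cyc_diff_cong[of i n j i j'] cyc_diff_cong[of i n j i' j]
      ij i' j' ne by (force simp: le_less)+
  then have "cyclically_cross n (i, j') (i', j)" by (simp add: cyclically_cross_def)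
  moreover have "\<not> cyclically_cross n (i, j') (i', j)"
    using neg ij i' j' ne by (auto simp: pairwise_def)
  ultimately show False by blast
qed

lemma noncrossing_conformal:
  fixes z :: "nat \<times> nat \<Rightarrow> real"
  assumes rows: "\<And>i. i \<le> n \<Longrightarrow> (\<Sum>j=0..n. z (i, j)) = 0"
    and cols: "\<And>j. j \<le> n \<Longrightarrow> (\<Sum>i=0..n. z (i, j)) = 0"
    and pos: "pairwise (\<lambda>a b. \<not> cyclically_cross n a b) {a \<in> {0..n} \<times> {0..n}. z a > 0}"
    and neg: "pairwise (\<lambda>a b. \<not> cyclically_cross n a b) {a \<in> {0..n} \<times> {0..n}. z a < 0}"
    and a: "a \<in> {0..n} \<times> {0..n}"
  shows "z a = 0"
proof (rule ccontr)
  let ?P = "\<lambda>b. b \<in> {0..n} \<times> {0..n} \<and> z b \<noteq> 0"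
  assume "z a \<noteq> 0"
  then have "?P a" using a by blast
  then obtain b where b: "?P b" "\<And>c. ?P c \<Longrightarrow> cyc_diff n (snd b) (fst b) \<le> cyc_diff n (snd c) (fst c)"
    using ex_has_least_nat[of ?P a "\<lambda>b. cyc_diff n (snd b) (fst b)"] by blast
  obtain i j where [simp]: "b = (i, j)" by (cases b)
  have ij: "i \<le> n" "j \<le> n" "z (i, j) \<noteq> 0" using b(1) by auto
  have least: "cyc_diff n j i \<le> cyc_diff n j' i'" if "i' \<le> n" "j' \<le> n" "z (i', j') \<noteq> 0" for i' j'
    using b(2)[of "(i', j')"] that by simp
  show False
  proof (cases "z (i, j) > 0")
    case True
    then show False using least_positive_arc_absurd[OF rows cols neg ij(1,2)] least by blast
  next
    case False
    then show False
      using least_positive_arc_absurd[of n "\<lambda>a. - z a" i j] rows cols pos ij least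
      by (simp add: sum_negf)
  qed
qed

section \<open>Heights that penalise crossings\<close>

text \<open>Ratio 1/2 lets the gain from one arc of smaller difference offset two arcs of larger
  difference.\<close>

definition arc_height :: "nat \<Rightarrow> nat \<times> nat \<Rightarrow> real" where
  "arc_height n = (\<lambda>(i, j). - ((1/2) ^ cyc_diff n j i))"

lemma half_power_dominates:
  assumes "k < l" "k < m"
  shows "(1/2 :: real) ^ l + (1/2) ^ m \<le> (1/2) ^ k"
proof -
  have "(1/2 :: real) ^ l \<le> (1/2) ^ Suc k" "(1/2 :: real) ^ m \<le> (1/2) ^ Suc k"
    using assms by (intro power_decreasing; simp)+
  then show ?thesis by simp
qed

text \<open>The arc of smaller difference in the exchanged pair already offsets both crossing arcs;
  strictness comes from the positive power contributed by its partner.\<close>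

lemma crossing_exchange_height:
  assumes "cyclically_cross n (i, j) (i', j')"
  shows "arc_height n (i', j) + arc_height n (i, j') < arc_height n (i, j) + arc_height n (i', j')"
proof -
  have pos: "(1/2 :: real) ^ k > 0" for k by simp
  show ?thesis
    using assms half_power_dominates[of "cyc_diff n j i'" "cyc_diff n j i" "cyc_diff n j' i'"]
      half_power_dominates[of "cyc_diff n j' i" "cyc_diff n j i" "cyc_diff n j' i'"]
      pos[of "cyc_diff n j i'"] pos[of "cyc_diff n j' i"]
    unfolding cyclically_cross_def arc_height_def prod.case by linarith
qed

section \<open>Transfer to the product of simplices\<close>

locale labelled_simplex_product =
  fixes n :: nat and e :: "nat \<Rightarrow> 'n::finite"
  assumes bij_e: "bij_betw e {0..n} UNIV"
begin

abbreviation arcs :: "(nat \<times> nat) set" where "arcs \<equiv> {0..n} \<times> {0..n}"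

definition arc_of :: "(real ^ 'n) \<times> (real ^ 'n) \<Rightarrow> nat \<times> nat" where
  "arc_of = inv_into arcs (arc_point e)"

lemma e_eq_iff: "i \<le> n \<Longrightarrow> j \<le> n \<Longrightarrow> e i = e j \<longleftrightarrow> i = j"
  using bij_e by (auto simp: bij_betw_def inj_on_def)

lemma inj_arc_point: "inj_on (arc_point e) arcs"
  by (auto simp: inj_on_def arc_point_def axis_eq_axis e_eq_iff)

lemma arc_of_arc_point [simp]: "a \<in> arcs \<Longrightarrow> arc_of (arc_point e a) = a"
  unfolding arc_of_def using inj_arc_point by (rule inv_into_f_f)

text \<open>Coordinate \<open>e k\<close> of the first component collects the arcs in row
  \<open>k\<close>, that of the second component the arcs in column \<open>k\<close>.\<close>

lemma arc_combination_margins: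
  fixes z :: "nat \<times> nat \<Rightarrow> real"
  assumes "(\<Sum>a\<in>arcs. z a *\<^sub>R arc_point e a) = 0" and k: "k \<le> n"
  shows "(\<Sum>j=0..n. z (k, j)) = 0" "(\<Sum>i=0..n. z (i, k)) = 0"
proof -
  have "0 = fst (\<Sum>a\<in>arcs. z a *\<^sub>R arc_point e a) $ e k" using assms(1) by simp
  also have "\<dots> = (\<Sum>i=0..n. \<Sum>j=0..n. z (i, j) * (if i = k then 1 else 0))"
    unfolding sum.cartesian_product using k
    by (auto simp: fst_sum arc_point_def axis_def e_eq_iff intro!: sum.cong)
  also have "\<dots> = (\<Sum>i=0..n. if i = k then \<Sum>j=0..n. z (i, j) else 0)"
    by (intro sum.cong) auto
  also have "\<dots> = (\<Sum>j=0..n. z (k, j))" using k by simp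
  finally show "(\<Sum>j=0..n. z (k, j)) = 0" by simp
  have "0 = snd (\<Sum>a\<in>arcs. z a *\<^sub>R arc_point e a) $ e k" using assms(1) by simp
  also have "\<dots> = (\<Sum>i=0..n. \<Sum>j=0..n. z (i, j) * (if j = k then 1 else 0))"
    unfolding sum.cartesian_product using k
    by (auto simp: snd_sum arc_point_def axis_def e_eq_iff intro!: sum.cong)
  also have "\<dots> = (\<Sum>i=0..n. z (i, k))"
    using k by (intro sum.cong) (auto simp: if_distrib cong: if_cong)
  finally show "(\<Sum>i=0..n. z (i, k)) = 0" by simp
qed

sublocale exchange_configuration "simplex_product_points n e"
  "\<lambda>x y. \<not> cyclically_cross n (arc_of x) (arc_of y)" "arc_height n \<circ> arc_of"
proof
  let ?V = "simplex_product_points n e"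
  show "finite ?V" by (simp add: simplex_product_points_def)
  fix z :: "(real ^ 'n) \<times> (real ^ 'n) \<Rightarrow> real"
  assume z: "(\<Sum>v\<in>?V. z v *\<^sub>R v) = 0"
    and pos: "pairwise (\<lambda>x y. \<not> cyclically_cross n (arc_of x) (arc_of y)) {v\<in>?V. z v > 0}"
    and neg: "pairwise (\<lambda>x y. \<not> cyclically_cross n (arc_of x) (arc_of y)) {v\<in>?V. z v < 0}"
  have sum0: "(\<Sum>a\<in>arcs. (z \<circ> arc_point e) a *\<^sub>R arc_point e a) = 0"
    using z by (simp add: simplex_product_points_def sum.reindex[OF inj_arc_point] o_def)
  \<comment> \<open>The predicate \<open>P\<close> on weights is left open so that the same fact
    serves both the positive and the negative part.\<close>
  have noncross: "\<not> cyclically_cross n a b"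
    if "pairwise (\<lambda>x y. \<not> cyclically_cross n (arc_of x) (arc_of y)) {v\<in>?V. P (z v)}"
      "a \<in> arcs" "b \<in> arcs" "P (z (arc_point e a))" "P (z (arc_point e b))" "a \<noteq> b" for P a b
    using pairwiseD[OF that(1), of "arc_point e a" "arc_point e b"] that(2-)
      inj_on_eq_iff[OF inj_arc_point that(2,3)]
    by (simp add: simplex_product_points_def)
  have "z (arc_point e a) = 0" if "a \<in> arcs" for a
  proof -
    have "(z \<circ> arc_point e) a = 0"
    proof (rule noncrossing_conformal[OF arc_combination_margins[OF sum0] _ _ that])
      show "pairwise (\<lambda>a b. \<not> cyclically_cross n a b) {a \<in> arcs. (z \<circ> arc_point e) a > 0}"
        using noncross[OF pos] by (simp add: pairwise_def)
      show "pairwise (\<lambda>a b. \<not> cyclically_cross n a b) {a \<in> arcs. (z \<circ> arc_point e) a < 0}"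
        using noncross[OF neg] by (simp add: pairwise_def)
    qed
    then show ?thesis by simp
  qed
  then show "\<forall>v\<in>?V. z v = 0" by (auto simp: simplex_product_points_def)
next
  let ?V = "simplex_product_points n e"
  fix x y assume xy: "x \<in> ?V" "y \<in> ?V" "\<not> \<not> cyclically_cross n (arc_of x) (arc_of y)"
  then obtain i j i' j' where ij: "x = arc_point e (i, j)" "y = arc_point e (i', j')"
      "(i, j) \<in> arcs" "(i', j') \<in> arcs"
    by (auto simp: simplex_product_points_def)
  have arcs': "(i', j) \<in> arcs" "(i, j') \<in> arcs" using ij by auto
  show "\<exists>c\<in>?V. \<exists>d\<in>?V. x + y = c + d \<and>
      (arc_height n \<circ> arc_of) c + (arc_height n \<circ> arc_of) d
        < (arc_height n \<circ> arc_of) x + (arc_height n \<circ> arc_of) y"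
  proof (intro bexI conjI)
    \<comment> \<open>The sum depends only on the multisets of first ends and of second ends, which
      the exchange preserves.\<close>
    show "x + y = arc_point e (i', j) + arc_point e (i, j')"
      by (simp add: ij arc_point_def add.commute)
    show "(arc_height n \<circ> arc_of) (arc_point e (i', j)) + (arc_height n \<circ> arc_of) (arc_point e (i, j'))
        < (arc_height n \<circ> arc_of) x + (arc_height n \<circ> arc_of) y"
      using crossing_exchange_height[of n i j i' j'] xy(3) ij arcs'
      by (simp del: mem_Sigma_iff)
  qed (use arcs' in \<open>auto simp: simplex_product_points_def\<close>)
qed

section \<open>Cyclic trees as maximal compatible sets\<close>

lemma compatible_arc_point_image:
  assumes "T \<subseteq> arcs"
  shows "compatible (arc_point e ` T) \<longleftrightarrow> cyclic_forest n {0..n} {0..n} T"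
proof -
  have "pairwise (\<lambda>x y. \<not> cyclically_cross n (arc_of x) (arc_of y)) (arc_point e ` T) \<longleftrightarrow>
      pairwise (\<lambda>a b. \<not> cyclically_cross n a b) T"
    unfolding pairwise_def ball_simps
  proof (intro ball_cong refl)
    fix a b assume "a \<in> T" "b \<in> T"
    then have "a \<in> arcs" "b \<in> arcs" using assms by blast+
    then show "(arc_point e a \<noteq> arc_point e b \<longrightarrow>
          \<not> cyclically_cross n (arc_of (arc_point e a)) (arc_of (arc_point e b))) \<longleftrightarrow>
        (a \<noteq> b \<longrightarrow> \<not> cyclically_cross n a b)"
      by (simp add: inj_on_eq_iff[OF inj_arc_point] del: mem_Sigma_iff)
  qed
  then show ?thesis
    using assms unfolding compatible_def cyclic_forest_def
    by (auto simp: simplex_product_points_def)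
qed

text \<open>Taking images under the injective \<open>arc_point e\<close> is an inclusion-preserving
  and inclusion-reflecting bijection from forests to compatible sets, so maximal elements
  correspond.\<close>

lemma maximal_compatible_iff:
  "compatible F \<and> (\<forall>G. compatible G \<and> F \<subseteq> G \<longrightarrow> G = F) \<longleftrightarrow>
     (\<exists>T. cyclic_tree n {0..n} {0..n} T \<and> F = arc_point e ` T)"
proof -
  have forest_arcs: "T \<subseteq> arcs" if "cyclic_forest n {0..n} {0..n} T" for T
    using that by (simp add: cyclic_forest_def)
  have comp_iff: "compatible F \<longleftrightarrow> (\<exists>T. cyclic_forest n {0..n} {0..n} T \<and> F = arc_point e ` T)" for F
  proof
    assume F: "compatible F"
    then have "F \<subseteq> arc_point e ` arcs"
      using compatible_sub unfolding simplex_product_points_def by blast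
    then obtain T where "T \<subseteq> arcs" "F = arc_point e ` T" by (metis subset_image_iff)
    then show "\<exists>T. cyclic_forest n {0..n} {0..n} T \<and> F = arc_point e ` T"
      using F compatible_arc_point_image by blast
  next
    assume "\<exists>T. cyclic_forest n {0..n} {0..n} T \<and> F = arc_point e ` T"
    then show "compatible F" using compatible_arc_point_image[OF forest_arcs] by auto
  qed
  have image_iff: "arc_point e ` T \<subseteq> arc_point e ` T' \<longleftrightarrow> T \<subseteq> T'"
    if "cyclic_forest n {0..n} {0..n} T" "cyclic_forest n {0..n} {0..n} T'" for T T'
    by (rule inj_on_image_subset_iff[OF inj_arc_point forest_arcs[OF that(1)] forest_arcs[OF that(2)]])
  show ?thesis
  proof (intro iffI conjI allI impI)
    assume F: "compatible F \<and> (\<forall>G. compatible G \<and> F \<subseteq> G \<longrightarrow> G = F)"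
    then obtain T where T: "cyclic_forest n {0..n} {0..n} T" "F = arc_point e ` T"
      using iffD1[OF comp_iff conjunct1[OF F]] by blast
    have "T' = T" if "cyclic_forest n {0..n} {0..n} T'" "T \<subseteq> T'" for T'
    proof -
      have "compatible (arc_point e ` T')"
        using compatible_arc_point_image[OF forest_arcs[OF that(1)]] that(1) by simp
      then have "arc_point e ` T' = F" using F T(2) image_mono[OF that(2)] by metis
      then show ?thesis using T that(2) image_iff[OF that(1) T(1)] by auto
    qed
    then show "\<exists>T. cyclic_tree n {0..n} {0..n} T \<and> F = arc_point e ` T"
      using T by (auto simp: cyclic_tree_def)
  next
    assume "\<exists>T. cyclic_tree n {0..n} {0..n} T \<and> F = arc_point e ` T"
    then show "compatible F" by (intro iffD2[OF comp_iff]) (auto simp: cyclic_tree_def)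
  next
    fix G assume "\<exists>T. cyclic_tree n {0..n} {0..n} T \<and> F = arc_point e ` T"
      and G: "compatible G \<and> F \<subseteq> G"
    then obtain T where T: "cyclic_tree n {0..n} {0..n} T" "F = arc_point e ` T" by blast
    obtain T' where T': "cyclic_forest n {0..n} {0..n} T'" "G = arc_point e ` T'"
      using iffD1[OF comp_iff conjunct1[OF G]] by blast
    have "T \<subseteq> T'" using G T T' image_iff[of T T'] by (simp add: cyclic_tree_def)
    then have "T' = T" using T(1) T'(1) by (simp add: cyclic_tree_def)
    then show "G = F" using T(2) T'(2) by simp
  qed
qed

end

theorem theorem6p1:
  fixes n :: nat and e :: "nat \<Rightarrow> 'n::finite"
  assumes "bij_betw e {0..n} (UNIV :: 'n set)"
  shows "\<exists>\<C>. \<C> triangulation_of (simplex_product_points n e) \<and>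
             maximal_simplices \<C> = {arc_simplex e T | T. cyclic_tree n {0..n} {0..n} T} \<and>
             flag_complex \<C> \<and>
             \<C> regular_triangulation_of (simplex_product_points n e)"
proof -
  interpret labelled_simplex_product n e using assms by unfold_locales
  have "maximal_simplices complex = {arc_simplex e T | T. cyclic_tree n {0..n} {0..n} T}"
    unfolding maximal_simplices_complex maximal_compatible_iff arc_simplex_def by blast
  then show ?thesis
    using triangulation_complex flag_complex_complex regular_triangulation_complex by blast
qed

end
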